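(* Let $n \geq 3$, let $X = (\mathbb{R}^n, \|\cdot\|)$ be a real $n$-dimensional normed space and let $Y = \ker f$, where $f \in S_{X^{\star}}$, be an $(n-1)$-dimensional subspace of $X$. Then $\lambda(Y, X) = 2 - \frac{2}{n}$ if and only if there exist extreme points $x_1, x_2, \ldots, x_n$ of the unit ball of $X$ such that the following conditions are satisfied: (1) $f(x_1)=f(x_2)=\ldots=f(x_n)$; (2) the vectors $x_1, x_2, \ldots, x_n$ are linearly independent; (3) if an arbitrary vector $x \in \mathbb{R}^n$ is written in the basis $x_1,\ldots,x_n$ as $x = \sum_{i=1}^{n} w_i x_i$, the following inequality holds: $$\max_{i=1, 2, \ldots, n} |w_1 + w_2 + \ldots + w_{i-1} - w_i + w_{i+1} + \ldots + w_n | \leq \|x\|.$$ Moreover, for such extreme points satisfying (1) and (2), condition (3) is equivalent to the fact that for every $1 \leq i \leq n$ the set $\{ x_1, x_2, \ldots, x_{i-1}, -x_i, x_{i+1}, \ldots, x_n\}$ is contained in a facet of the unit ball of $X$.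
   Context: All normed spaces are real. For a subspace $Y$ of a normed space $X$, a projection from $X$ onto $Y$ is a bounded linear operator $P: X \to Y$ with $P|_Y = \mathrm{Id}_Y$; $\mathcal{P}(X,Y)$ is the set of all such projections and the relative projection constant is $\lambda(Y,X) = \inf\{\|P\| : P \in \mathcal{P}(X,Y)\}$. $S_{X^\star}$ is the unit sphere of the dual space $X^\star$. A face of a convex body in $\mathbb{R}^n$ is its intersection with some supporting hyperplane; a face is a facet if it is $(n-1)$-dimensional, i.e. not contained in an affine subspace of dimension $n-2$. *)

theory Defs
  imports "HOL-Analysis.Analysis"
begin

text \<open>
  The norm of the space is an arbitrary function \<open>N\<close>, because the type \<open>real ^ 'n\<close> already
  carries the Euclidean norm as its type class norm.
\<close>

definition norm_fun :: "('a::real_vector \<Rightarrow> real) \<Rightarrow> bool" where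
  "norm_fun N \<longleftrightarrow>
     (\<forall>x. N x = 0 \<longleftrightarrow> x = 0) \<and>
     (\<forall>c x. N (c *\<^sub>R x) = \<bar>c\<bar> * N x) \<and>
     (\<forall>x y. N (x + y) \<le> N x + N y)"

definition unit_ball :: "('a::real_vector \<Rightarrow> real) \<Rightarrow> 'a set" where
  "unit_ball N = {x. N x \<le> 1}"

definition bounded_operator ::
  "('a::real_vector \<Rightarrow> real) \<Rightarrow> ('b::real_vector \<Rightarrow> real) \<Rightarrow> ('a \<Rightarrow> 'b) \<Rightarrow> bool" where
  "bounded_operator N M T \<longleftrightarrow> linear T \<and> (\<exists>K. \<forall>x. M (T x) \<le> K * N x)"

definition operator_norm ::
  "('a::real_vector \<Rightarrow> real) \<Rightarrow> ('b::real_vector \<Rightarrow> real) \<Rightarrow> ('a \<Rightarrow> 'b) \<Rightarrow> real" where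
  "operator_norm N M T = (SUP x\<in>unit_ball N. M (T x))"

definition dual_unit_sphere :: "('a::real_vector \<Rightarrow> real) \<Rightarrow> ('a \<Rightarrow> real) set" where
  "dual_unit_sphere N = {f. bounded_operator N abs f \<and> operator_norm N abs f = 1}"

definition projections :: "('a::real_vector \<Rightarrow> real) \<Rightarrow> 'a set \<Rightarrow> ('a \<Rightarrow> 'a) set" where
  "projections N Y = {P. bounded_operator N N P \<and> range P \<subseteq> Y \<and> (\<forall>y\<in>Y. P y = y)}"

definition projection_constant :: "('a::real_vector \<Rightarrow> real) \<Rightarrow> 'a set \<Rightarrow> real" where
  "projection_constant N Y = (INF P\<in>projections N Y. operator_norm N N P)"

definition supporting_hyperplane :: "'a::euclidean_space set \<Rightarrow> 'a set \<Rightarrow> bool" where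
  "supporting_hyperplane K H \<longleftrightarrow>
     (\<exists>a b. a \<noteq> 0 \<and> H = {x. a \<bullet> x = b} \<and> K \<subseteq> {x. a \<bullet> x \<le> b} \<and> K \<inter> H \<noteq> {})"

text \<open>
  Faces are cut out by supporting hyperplanes, so they are exposed faces; the library relation
  \<open>face_of\<close> is more general.
\<close>

definition body_face :: "'a::euclidean_space set \<Rightarrow> 'a set \<Rightarrow> bool" where
  "body_face K F \<longleftrightarrow> (\<exists>H. supporting_hyperplane K H \<and> F = K \<inter> H)"

definition body_facet :: "'a::euclidean_space set \<Rightarrow> 'a set \<Rightarrow> bool" where
  "body_facet K F \<longleftrightarrow> body_face K F \<and> aff_dim F = int DIM('a) - 1"

end

theory Submission
  imports Defs
begin

text \<open>
  Write \<open>f v = \<phi> \<bullet> v\<close> and \<open>n\<close> for the dimension. The projections onto \<open>ker f\<close> are the maps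
  \<open>P v = v - (\<phi> \<bullet> v) z\<close> with \<open>\<phi> \<bullet> z = 1\<close>. Linear independence of the \<open>x i\<close> together with the
  inequality for the coordinates, or with the condition on facets, expresses one fact: there are
  functionals \<open>a i\<close> of norm at most \<open>1\<close> which take the value \<open>1\<close> at every \<open>x j\<close> with \<open>j \<noteq> i\<close> and
  the value \<open>-1\<close> at \<open>x i\<close>. Such functionals are called flipping for \<open>x\<close>. For \<open>n \<ge> 3\<close> they force
  the \<open>x i\<close> to be a basis, and if the \<open>x i\<close> lie in the ball, they force them to be extreme
  points, because the functionals attain their extreme values there and separate points.

  Flipping functionals for points of the ball on a common level of \<open>f\<close> give the lower bound
  \<open>2 - 2 / n\<close> for every projection: evaluating \<open>a i\<close> at \<open>P (x i)\<close> gives \<open>2 t - 2\<close>, where \<open>t\<close> is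
  the share of \<open>f z = 1\<close> contributed by the \<open>i\<close>-th coordinate of \<open>z\<close>, and some share is at most
  \<open>1 / n\<close> (\<open>flipping_projection_lower_bound\<close>).

  The other direction is linear programming duality. The norm of \<open>P\<close> is the maximum of
  \<open>a \<bullet> P x = z \<bullet> ((a \<bullet> x) \<phi> - (\<phi> \<bullet> x) a)\<close> over the unit ball and the dual ball, so minimizing it
  over \<open>z\<close> amounts to finding the last point \<open>M \<phi>\<close> on the ray through \<open>\<phi>\<close> in the convex hull of
  the vectors \<open>(a \<bullet> x) \<phi> - (\<phi> \<bullet> x) a\<close>. That point lies on the boundary, so \<open>n\<close> of these vectors
  suffice to represent it (\<open>exists_optimal_multipliers\<close>). Pairing the representation with each of
  its own points \<open>x j\<close> and using only \<open>\<bar>a i \<bullet> x j\<bar> \<le> 1\<close> gives a scalar inequality for each \<open>j\<close>. A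
  tangent line estimate for \<open>l / (\<kappa> + 2 l)\<close>, \<open>\<kappa> = 1 - 2 / n\<close>, combines them to \<open>M \<le> 2 - 2 / n\<close>,
  and equality forces all weights to be \<open>1 / n\<close>, all values \<open>\<phi> \<bullet> x j\<close> to agree, and
  \<open>a i \<bullet> x i = 1\<close>, \<open>a i \<bullet> x j = -1\<close> (\<open>extremal_multipliers\<close>): the functionals \<open>- a i\<close> are
  flipping.
\<close>

section \<open>Norms as functions and their dual balls\<close>

lemma norm_funD:
  assumes "norm_fun N"
  shows norm_fun_eq_0: "N x = 0 \<longleftrightarrow> x = 0"
    and norm_fun_scale: "N (c *\<^sub>R x) = \<bar>c\<bar> * N x"
    and norm_fun_triangle: "N (x + y) \<le> N x + N y"
  using assms by (auto simp: norm_fun_def)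

lemma norm_fun_minus: "norm_fun N \<Longrightarrow> N (- x) = N x"
  using norm_fun_scale[of N "-1" x] by simp

lemma norm_fun_zero: "norm_fun N \<Longrightarrow> N 0 = 0"
  by (simp add: norm_fun_eq_0)

lemma norm_fun_nonneg: "norm_fun N \<Longrightarrow> 0 \<le> N x"
  using norm_fun_triangle[of N x "- x"] by (simp add: norm_fun_minus norm_fun_zero)

lemma zero_in_unit_ball: "norm_fun N \<Longrightarrow> 0 \<in> unit_ball N"
  by (simp add: unit_ball_def norm_fun_zero)

lemma convex_on_norm_fun:
  assumes "norm_fun N"
  shows "convex_on UNIV N"
proof (rule convex_onI)
  fix t x y
  assume "0 < t" "t < (1::real)"
  then show "N ((1 - t) *\<^sub>R x + t *\<^sub>R y) \<le> (1 - t) * N x + t * N y"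
    using norm_fun_triangle[OF assms, of "(1 - t) *\<^sub>R x" "t *\<^sub>R y"]
    by (simp add: norm_fun_scale[OF assms])
qed auto

lemma continuous_on_norm_fun:
  fixes N :: "'a::euclidean_space \<Rightarrow> real"
  shows "norm_fun N \<Longrightarrow> continuous_on S N"
  using convex_on_continuous[OF open_UNIV convex_on_norm_fun] continuous_on_subset by blast

text \<open>
  This is what makes the unit ball and the dual ball compact in the Euclidean topology: the
  extrema of \<open>N\<close> on the Euclidean sphere are the constants.
\<close>

lemma norm_fun_equivalent_norm:
  fixes N :: "'a::euclidean_space \<Rightarrow> real"
  assumes "norm_fun N"
  obtains k K where "0 < k" "\<And>x. k * norm x \<le> N x" "\<And>x. N x \<le> K * norm x"
proof -
  have ne: "sphere (0::'a) 1 \<noteq> {}" by simp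
  obtain u where u: "u \<in> sphere 0 1" "\<And>x. x \<in> sphere 0 1 \<Longrightarrow> N u \<le> N x"
    using continuous_attains_inf[OF compact_sphere ne continuous_on_norm_fun[OF assms]] by auto
  obtain v where v: "\<And>x. x \<in> sphere 0 1 \<Longrightarrow> N x \<le> N v"
    using continuous_attains_sup[OF compact_sphere ne continuous_on_norm_fun[OF assms]] by blast
  have "0 < N u"
    using u(1) norm_fun_eq_0[OF assms, of u] norm_fun_nonneg[OF assms, of u] by force
  moreover have "N u * norm x \<le> N x \<and> N x \<le> N v * norm x" for x
  proof (cases "x = 0")
    case False
    define y where "y = x /\<^sub>R norm x"
    have y: "y \<in> sphere 0 1" and x: "x = norm x *\<^sub>R y" using False by (auto simp: y_def)
    have "N x = norm x * N y" by (subst x) (simp add: norm_fun_scale[OF assms])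
    then show ?thesis using u(2)[OF y] v[OF y]
      by (auto simp: mult.commute[of _ "norm x"] intro: mult_left_mono)
  qed (simp add: norm_fun_zero[OF assms])
  ultimately show ?thesis using that by blast
qed

lemma convex_unit_ball: 
  assumes "norm_fun N" shows "convex (unit_ball N)"
proof (rule convexI)
  fix x y and u v :: real
  assume "x \<in> unit_ball N" "y \<in> unit_ball N" and uv: "0 \<le> u" "0 \<le> v" "u + v = 1"
  then have "u * N x + v * N y \<le> 1" by (intro convex_bound_le) (auto simp: unit_ball_def)
  then show "u *\<^sub>R x + v *\<^sub>R y \<in> unit_ball N"
    using norm_fun_triangle[OF assms, of "u *\<^sub>R x" "v *\<^sub>R y"] uv
    by (simp add: unit_ball_def norm_fun_scale[OF assms])
qed

lemma compact_unit_ball: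
  fixes N :: "'a::euclidean_space \<Rightarrow> real"
  assumes "norm_fun N"
  shows "compact (unit_ball N)"
proof -
  obtain k where k: "0 < k" "\<And>x. k * norm x \<le> N x"
    using norm_fun_equivalent_norm[OF assms] by metis
  have "closed (unit_ball N)" unfolding unit_ball_def
    by (intro closed_Collect_le continuous_on_norm_fun[OF assms] continuous_on_const)
  moreover have "unit_ball N \<subseteq> cball 0 (1 / k)"
  proof
    fix x assume "x \<in> unit_ball N"
    then have "k * norm x \<le> 1" using k(2)[of x] by (simp add: unit_ball_def)
    then show "x \<in> cball 0 (1 / k)" using k(1) by (simp add: field_simps)
  qed
  ultimately show ?thesis
    using bounded_subset bounded_cball compact_eq_bounded_closed by blast
qed

text \<open>
  A functional is represented by the vector with which it takes the inner product, so the unit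
  ball of the dual space becomes a compact subset of the same Euclidean space.
\<close>

definition dual_ball :: "('a::real_inner \<Rightarrow> real) \<Rightarrow> 'a set" where
  "dual_ball N = {a. \<forall>x. a \<bullet> x \<le> N x}"

lemma dual_ball_abs:
  assumes "norm_fun N" "a \<in> dual_ball N"
  shows "\<bar>a \<bullet> x\<bar> \<le> N x"
proof -
  have "a \<bullet> x \<le> N x" "a \<bullet> (- x) \<le> N (- x)" using assms(2) unfolding dual_ball_def by blast+
  then show ?thesis using norm_fun_minus[OF assms(1), of x] by simp
qed

lemma dual_ball_uminus:
  assumes "norm_fun N" "a \<in> dual_ball N"
  shows "- a \<in> dual_ball N"
  unfolding dual_ball_def
proof safe
  fix x
  show "- a \<bullet> x \<le> N x" using dual_ball_abs[OF assms, of x] by simp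
qed

lemma dual_ballI_unit_ball:
  assumes N: "norm_fun N" and a: "\<And>x. x \<in> unit_ball N \<Longrightarrow> a \<bullet> x \<le> 1"
  shows "a \<in> dual_ball N"
  unfolding dual_ball_def
proof safe
  fix x
  show "a \<bullet> x \<le> N x"
  proof (cases "x = 0")
    case False
    then have pos: "0 < N x"
      using norm_fun_nonneg[OF N, of x] norm_fun_eq_0[OF N, of x] by linarith
    then have "a \<bullet> (x /\<^sub>R N x) \<le> 1"
      by (intro a) (simp add: unit_ball_def norm_fun_scale[OF N])
    then show ?thesis using pos by (simp add: field_simps)
  qed (simp add: norm_fun_nonneg[OF N])
qed

lemma compact_dual_ball:
  fixes N :: "'a::euclidean_space \<Rightarrow> real"
  assumes "norm_fun N"
  shows "compact (dual_ball N)"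
proof -
  obtain K where K: "\<And>x. N x \<le> K * norm x"
    using norm_fun_equivalent_norm[OF assms] by metis
  have "dual_ball N = (\<Inter>x. {a. x \<bullet> a \<le> N x})"
    by (auto simp: dual_ball_def inner_commute)
  then have "closed (dual_ball N)" by (auto intro: closed_halfspace_le)
  moreover have "dual_ball N \<subseteq> cball 0 (max K 0)"
  proof
    fix a assume "a \<in> dual_ball N"
    then have "a \<bullet> a \<le> K * norm a" unfolding dual_ball_def
      using K[of a] order_trans by blast
    then have "norm a * norm a \<le> K * norm a" by (simp add: dot_square_norm power2_eq_square)
    then have "norm a \<le> max K 0" by (cases "a = 0") auto
    then show "a \<in> cball 0 (max K 0)" by simp
  qed
  ultimately show ?thesis
    using bounded_subset bounded_cball compact_eq_bounded_closed by blast
qed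

text \<open>
  The norming half of the Hahn--Banach theorem. If \<open>N y > c\<close>, a hyperplane separates \<open>y / c\<close> from
  the unit ball, and rescaling its normal vector to the separating value gives an element of the
  dual ball that exceeds \<open>c\<close> at \<open>y\<close>.
\<close>

lemma norm_fun_le_dual:
  fixes N :: "'a::euclidean_space \<Rightarrow> real"
  assumes N: "norm_fun N" and "0 < c" and le: "\<And>a. a \<in> dual_ball N \<Longrightarrow> a \<bullet> y \<le> c"
  shows "N y \<le> c"
proof (rule ccontr)
  assume "\<not> N y \<le> c"
  then have "y /\<^sub>R c \<notin> unit_ball N"
    using \<open>0 < c\<close> by (simp add: unit_ball_def norm_fun_scale[OF N] field_simps)
  then obtain a b where ab: "a \<bullet> (y /\<^sub>R c) < b" "\<And>x. x \<in> unit_ball N \<Longrightarrow> b < a \<bullet> x"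
    using separating_hyperplane_closed_point
      [OF convex_unit_ball[OF N] compact_imp_closed[OF compact_unit_ball[OF N]]] by blast
  have "0 \<in> unit_ball N" by (rule zero_in_unit_ball[OF N])
  then have b: "b < 0" using ab(2) by force
  have "a /\<^sub>R b \<in> dual_ball N"
  proof (rule dual_ballI_unit_ball[OF N])
    fix x assume "x \<in> unit_ball N"
    then show "(a /\<^sub>R b) \<bullet> x \<le> 1" using ab(2)[of x] b by (simp add: field_simps)
  qed
  then have "(a /\<^sub>R b) \<bullet> y \<le> c" by (rule le)
  then show False using ab(1) b \<open>0 < c\<close> by (simp add: field_simps)
qed

section \<open>Projections onto a hyperplane\<close>

lemma operator_norm_upper:
  assumes N: "norm_fun N" and T: "bounded_operator N M T" and x: "x \<in> unit_ball N"
  shows "M (T x) \<le> operator_norm N M T"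
proof -
  obtain K where K: "\<And>x. M (T x) \<le> K * N x" using T by (auto simp: bounded_operator_def)
  have "M (T y) \<le> \<bar>K\<bar>" if "y \<in> unit_ball N" for y
  proof -
    have "K * N y \<le> \<bar>K\<bar> * N y" by (simp add: mult_right_mono norm_fun_nonneg[OF N])
    also have "\<dots> \<le> \<bar>K\<bar>" using that by (simp add: unit_ball_def mult_left_le)
    finally show ?thesis using K[of y] by linarith
  qed
  then have "bdd_above ((\<lambda>x. M (T x)) ` unit_ball N)" by (rule bdd_aboveI2)
  then show ?thesis unfolding operator_norm_def using x by (rule cSUP_upper[rotated])
qed

lemma operator_norm_least:
  assumes "norm_fun N" "\<And>x. x \<in> unit_ball N \<Longrightarrow> M (T x) \<le> c"
  shows "operator_norm N M T \<le> c"
proof -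
  have "0 \<in> unit_ball N" by (rule zero_in_unit_ball[OF assms(1)])
  then show ?thesis unfolding operator_norm_def using assms(2) by (intro cSUP_least) auto
qed

lemma rank_one_projection:
  fixes N :: "'a::euclidean_space \<Rightarrow> real"
  assumes N: "norm_fun N" and z: "\<phi> \<bullet> z = 1"
  shows "(\<lambda>v. v - (\<phi> \<bullet> v) *\<^sub>R z) \<in> projections N {v. \<phi> \<bullet> v = 0}"
proof -
  obtain k where k: "0 < k" "\<And>x. k * norm x \<le> N x"
    using norm_fun_equivalent_norm[OF N] by metis
  have "N (v - (\<phi> \<bullet> v) *\<^sub>R z) \<le> (1 + norm \<phi> / k * N z) * N v" for v
  proof -
    have "N (v - (\<phi> \<bullet> v) *\<^sub>R z) \<le> N v + \<bar>\<phi> \<bullet> v\<bar> * N z"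
      using norm_fun_triangle[OF N, of v "(- (\<phi> \<bullet> v)) *\<^sub>R z"] norm_fun_scale[OF N, of "- (\<phi> \<bullet> v)" z]
      by simp
    moreover have "\<bar>\<phi> \<bullet> v\<bar> \<le> norm \<phi> * (N v / k)"
    proof -
      have "norm v \<le> N v / k" using k(2)[of v] k(1) by (simp add: field_simps)
      then show ?thesis using Cauchy_Schwarz_ineq2[of \<phi> v]
        by (meson mult_left_mono norm_ge_zero order_trans)
    qed
    then have "\<bar>\<phi> \<bullet> v\<bar> * N z \<le> norm \<phi> * (N v / k) * N z"
      by (rule mult_right_mono) (rule norm_fun_nonneg[OF N])
    ultimately show ?thesis by (simp add: algebra_simps)
  qed
  moreover have "linear (\<lambda>v. v - (\<phi> \<bullet> v) *\<^sub>R z)"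
    by (rule linearI) (auto simp: algebra_simps)
  ultimately show ?thesis
    using z by (auto simp: projections_def bounded_operator_def inner_diff_right)
qed

text \<open>
  A projection onto a hyperplane is determined by its value at one vector \<open>u\<close> off the hyperplane,
  here normalized by \<open>\<phi> \<bullet> u = 1\<close>; then \<open>z\<close> is the component \<open>u - P u\<close> of \<open>u\<close> that \<open>P\<close> kills.
\<close>

lemma projection_rank_one:
  fixes \<phi> :: "'a::euclidean_space"
  assumes "\<phi> \<noteq> 0" and P: "P \<in> projections N {v. \<phi> \<bullet> v = 0}"
  obtains z where "\<phi> \<bullet> z = 1" "P = (\<lambda>v. v - (\<phi> \<bullet> v) *\<^sub>R z)"
proof -
  define u where "u = \<phi> /\<^sub>R (\<phi> \<bullet> \<phi>)"
  have u: "\<phi> \<bullet> u = 1" using assms(1) by (simp add: u_def)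
  have lin: "linear P" and ran: "\<phi> \<bullet> P v = 0" and fix_ker: "\<phi> \<bullet> v = 0 \<Longrightarrow> P v = v" for v
    using P by (auto simp: projections_def bounded_operator_def)
  have "P v = v - (\<phi> \<bullet> v) *\<^sub>R (u - P u)" for v
  proof -
    have "P (v - (\<phi> \<bullet> v) *\<^sub>R u) = v - (\<phi> \<bullet> v) *\<^sub>R u" by (rule fix_ker) (simp add: inner_diff_right u)
    then show ?thesis by (simp add: linear_diff[OF lin] linear_cmul[OF lin] algebra_simps)
  qed
  moreover have "\<phi> \<bullet> (u - P u) = 1" by (simp add: inner_diff_right u ran)
  ultimately show ?thesis using that by blast
qed

lemma projections_nonempty:
  fixes \<phi> :: "'a::euclidean_space"
  assumes "norm_fun N" "\<phi> \<noteq> 0"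
  shows "projections N {v. \<phi> \<bullet> v = 0} \<noteq> {}"
  using rank_one_projection[OF assms(1), of \<phi> "\<phi> /\<^sub>R (\<phi> \<bullet> \<phi>)"] assms(2) by force

lemma operator_norm_nonneg:
  assumes "norm_fun N" "bounded_operator N N T"
  shows "0 \<le> operator_norm N N T"
proof -
  have "0 \<in> unit_ball N" by (rule zero_in_unit_ball[OF assms(1)])
  then show ?thesis using operator_norm_upper[OF assms] norm_fun_nonneg[OF assms(1)] order_trans by blast
qed

lemma projection_constant_le:
  assumes "norm_fun N" "P \<in> projections N Y"
  shows "projection_constant N Y \<le> operator_norm N N P"
  unfolding projection_constant_def
proof (rule cINF_lower[OF _ assms(2)])
  show "bdd_below (operator_norm N N ` projections N Y)"
    by (rule bdd_belowI2[of _ 0]) (auto simp: projections_def intro: operator_norm_nonneg[OF assms(1)])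
qed

section \<open>Bases indexed by a finite type\<close>

text \<open>
  Coefficients indexed by the index type avoid reindexing sums over the range of the family; in
  particular a change of sign of one vector becomes a change of sign of one coefficient.
\<close>

lemma independent_family_iff:
  fixes x :: "'i::finite \<Rightarrow> 'a::real_vector"
  shows "inj x \<and> independent (range x) \<longleftrightarrow>
    (\<forall>w. (\<Sum>j\<in>UNIV. w j *\<^sub>R x j) = 0 \<longrightarrow> (\<forall>j. w j = 0))"
proof (intro iffI allI impI conjI)
  fix w j
  assume x: "inj x \<and> independent (range x)" and w: "(\<Sum>j\<in>UNIV. w j *\<^sub>R x j) = 0"
  have "(\<Sum>v\<in>range x. w (inv x v) *\<^sub>R v) = 0"
    using w x by (simp add: sum.reindex)
  then show "w j = 0"
    using x independentD[of "range x" "range x" "\<lambda>v. w (inv x v)" "x j"] by simp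
next
  assume zero: "\<forall>w. (\<Sum>j\<in>UNIV. w j *\<^sub>R x j) = 0 \<longrightarrow> (\<forall>j. w j = 0)"
  show inj: "inj x"
  proof (rule injI, rule ccontr)
    fix i j assume eq: "x i = x j" and "i \<noteq> j"
    define w :: "'i \<Rightarrow> real" where "w k = (if k = i then 1 else 0) - (if k = j then 1 else 0)" for k
    have "(\<Sum>k\<in>UNIV. w k *\<^sub>R x k) =
        (\<Sum>k\<in>UNIV. if k = i then x k else 0) - (\<Sum>k\<in>UNIV. if k = j then x k else 0)"
      unfolding w_def scaleR_diff_left sum_subtractf by (intro arg_cong2[where f = minus] sum.cong) auto
    also have "\<dots> = 0" using eq by simp
    finally have "w i = 0" using zero by blast
    then show False using \<open>i \<noteq> j\<close> by (simp add: w_def)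
  qed
  show "independent (range x)"
  proof (rule independent_if_scalars_zero)
    fix g v assume "(\<Sum>v\<in>range x. g v *\<^sub>R v) = 0" "v \<in> range x"
    then show "g v = 0" using zero[rule_format, of "g \<circ> x"] by (auto simp: sum.reindex[OF inj])
  qed simp
qed

lemma basis_family_expansion:
  fixes x :: "'i::finite \<Rightarrow> 'a::euclidean_space"
  assumes "inj x" "independent (range x)" "CARD('i) = DIM('a)"
  obtains w where "v = (\<Sum>j\<in>UNIV. w j *\<^sub>R x j)"
proof -
  have "v \<in> span (range x)"
    using card_ge_dim_independent[of "range x" UNIV] assms by (auto simp: card_image)
  then obtain u where "v = (\<Sum>b\<in>range x. u b *\<^sub>R b)"
    unfolding span_finite[OF finite_imageI[OF finite]] by blast
  then have "v = (\<Sum>j\<in>UNIV. u (x j) *\<^sub>R x j)" by (simp add: sum.reindex[OF assms(1)])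
  then show ?thesis by (rule that)
qed

lemma linear_functional_inner:
  fixes g :: "'a::euclidean_space \<Rightarrow> real"
  assumes "linear g"
  obtains a where "\<And>v. g v = a \<bullet> v"
  using adjoint_works[OF assms, of _ 1] that[of "adjoint g 1"] by (simp add: inner_commute)

section \<open>Flipping functionals\<close>

text \<open>
  In coordinates with respect to a basis \<open>x\<close>, the functional \<open>a i\<close> is the sum of all coordinates
  with the sign of the \<open>i\<close>-th one flipped. The inequality for the coordinates says that these
  functionals have norm at most \<open>1\<close>.
\<close>

definition flipping ::
  "('a::real_inner \<Rightarrow> real) \<Rightarrow> ('i \<Rightarrow> 'a) \<Rightarrow> ('i \<Rightarrow> 'a) \<Rightarrow> bool" where
  "flipping N a x \<longleftrightarrow> (\<forall>i. a i \<in> dual_ball N \<and> (\<forall>j. a i \<bullet> x j = (if j = i then - 1 else 1)))"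

lemma flip_inner_combination:
  fixes x :: "'i::finite \<Rightarrow> 'a::real_inner"
  assumes "\<And>j. b \<bullet> x j = (if j = i then - 1 else 1)"
  shows "b \<bullet> (\<Sum>j\<in>UNIV. w j *\<^sub>R x j) = (\<Sum>j\<in>UNIV - {i}. w j) - w i"
proof -
  have "b \<bullet> (\<Sum>j\<in>UNIV. w j *\<^sub>R x j) = (\<Sum>j\<in>UNIV. w j * (if j = i then - 1 else 1))"
    by (simp add: inner_sum_right assms)
  also have "\<dots> = - w i + (\<Sum>j\<in>UNIV - {i}. w j * (if j = i then - 1 else 1))"
    by (simp add: sum.remove[of UNIV i])
  also have "\<dots> = - w i + (\<Sum>j\<in>UNIV - {i}. w j)" by simp
  finally show ?thesis by simp
qed

text \<open>
  All \<open>w i\<close> equal half of their sum \<open>s\<close>, so \<open>2 s = n s\<close>. For \<open>n = 2\<close> this fails, since the two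
  sums are then negatives of each other.
\<close>

lemma flip_sums_zero:
  fixes w :: "'i::finite \<Rightarrow> real"
  assumes card: "CARD('i) \<ge> 3" and zero: "\<And>i. (\<Sum>j\<in>UNIV - {i}. w j) - w i = 0"
  shows "w i = 0"
proof -
  have w: "2 * w i = sum w UNIV" for i
    using zero[of i] sum.remove[of UNIV i w] by simp
  have "2 * sum w UNIV = real CARD('i) * sum w UNIV"
    by (simp add: sum_distrib_left w)
  then have "sum w UNIV = 0" using card by simp
  then show ?thesis using w[of i] by simp
qed

lemma flipping_independent:
  fixes x :: "'i::finite \<Rightarrow> 'a::real_inner"
  assumes "CARD('i) \<ge> 3" "flipping N a x"
  shows "inj x \<and> independent (range x)"
  unfolding independent_family_iff
proof (intro allI impI)
  fix w j assume w: "(\<Sum>j\<in>UNIV. w j *\<^sub>R x j) = 0"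
  have "(\<Sum>j\<in>UNIV - {i}. w j) - w i = 0" for i
    using flip_inner_combination[of "a i" x i w] assms(2) by (simp add: w flipping_def)
  then show "w j = 0" by (rule flip_sums_zero[OF assms(1)])
qed

lemma flipping_separates:
  fixes x :: "'i::finite \<Rightarrow> 'a::euclidean_space"
  assumes "CARD('i) \<ge> 3" "CARD('i) = DIM('a)" "flipping N a x" and eq: "\<And>i. a i \<bullet> y = a i \<bullet> z"
  shows "y = z"
proof -
  obtain w where w: "y - z = (\<Sum>j\<in>UNIV. w j *\<^sub>R x j)"
    using basis_family_expansion[of x "y - z"] flipping_independent[OF assms(1,3)] assms(2) by blast
  have "(\<Sum>j\<in>UNIV - {i}. w j) - w i = 0" for i
    using flip_inner_combination[of "a i" x i w] assms(3) eq[of i]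
    by (simp add: flipping_def inner_diff_right flip: w)
  then have "w j = 0" for j by (rule flip_sums_zero[OF assms(1)])
  then show ?thesis using w by simp
qed

lemma convex_combination_eq_bound:
  fixes p q u :: real
  assumes "0 < u" "u < 1" "p \<le> 1" "q \<le> 1" "(1 - u) * p + u * q = 1"
  shows "p = 1" "q = 1"
proof -
  have "(1 - u) * (1 - p) + u * (1 - q) = 0" using assms(5) by (simp add: algebra_simps)
  moreover have "0 \<le> (1 - u) * (1 - p)" "0 \<le> u * (1 - q)" using assms by auto
  ultimately have "(1 - u) * (1 - p) = 0" "u * (1 - q) = 0" by linarith+
  then show "p = 1" "q = 1" using assms by auto
qed

text \<open>
  Each \<open>a k\<close> attains \<open>1\<close> or \<open>-1\<close>, its extreme values on the ball, at \<open>x i\<close>. So if \<open>x i\<close> lies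
  inside a segment of the ball, each \<open>a k\<close> is constant on that segment, which is therefore a
  point.
\<close>

lemma flipping_extreme_point:
  fixes x :: "'i::finite \<Rightarrow> 'a::euclidean_space"
  assumes N: "norm_fun N" and "CARD('i) \<ge> 3" "CARD('i) = DIM('a)" and a: "flipping N a x"
    and x: "x i \<in> unit_ball N"
  shows "x i extreme_point_of unit_ball N"
  unfolding extreme_point_of_def
proof (intro conjI x ballI notI)
  fix y z assume yz: "y \<in> unit_ball N" "z \<in> unit_ball N" "x i \<in> open_segment y z"
  then obtain u where u: "0 < u" "u < 1" "x i = (1 - u) *\<^sub>R y + u *\<^sub>R z" and "y \<noteq> z"
    unfolding in_segment by blast
  have "a k \<bullet> y = a k \<bullet> z" for k
  proof -
    have "a k \<in> dual_ball N" using a by (simp add: flipping_def)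
    then have "\<bar>a k \<bullet> y\<bar> \<le> 1" "\<bar>a k \<bullet> z\<bar> \<le> 1"
      using dual_ball_abs[OF N, of "a k"] yz(1,2) order_trans unfolding unit_ball_def by blast+
    then have le: "a k \<bullet> y \<le> 1" "a k \<bullet> z \<le> 1" "- (a k \<bullet> y) \<le> 1" "- (a k \<bullet> z) \<le> 1" by linarith+
    have comb: "(1 - u) * (a k \<bullet> y) + u * (a k \<bullet> z) = a k \<bullet> x i"
      by (simp add: u(3) inner_add_right)
    show ?thesis
    proof (cases "k = i")
      case True
      then have "(1 - u) * (- (a k \<bullet> y)) + u * (- (a k \<bullet> z)) = 1"
        using comb a by (simp add: flipping_def)
      then show ?thesis using convex_combination_eq_bound[OF u(1,2) le(3,4)] by simp
    next
      case False
      then have "(1 - u) * (a k \<bullet> y) + u * (a k \<bullet> z) = 1"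
        using comb a by (simp add: flipping_def)
      then show ?thesis using convex_combination_eq_bound[OF u(1,2) le(1,2)] by simp
    qed
  qed
  then show False using flipping_separates[OF assms(2,3) a] \<open>y \<noteq> z\<close> by blast
qed

text \<open>
  The only candidate for \<open>a i\<close> is the functional with the prescribed values on the basis \<open>x\<close>, and
  the inequality says that it belongs to the dual ball.
\<close>

lemma ex_flipping_iff_inequality:
  fixes x :: "'i::finite \<Rightarrow> 'a::euclidean_space"
  assumes N: "norm_fun N" and card: "CARD('i) = DIM('a)" and x: "inj x" "independent (range x)"
  shows "(\<exists>a. flipping N a x) \<longleftrightarrow>
    (\<forall>w i. \<bar>(\<Sum>j\<in>UNIV - {i}. w j) - w i\<bar> \<le> N (\<Sum>j\<in>UNIV. w j *\<^sub>R x j))"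
proof (intro iffI allI)
  fix w i
  assume "\<exists>a. flipping N a x"
  then obtain a where a: "a i \<in> dual_ball N" "\<And>j. a i \<bullet> x j = (if j = i then - 1 else 1)"
    unfolding flipping_def by blast
  show "\<bar>(\<Sum>j\<in>UNIV - {i}. w j) - w i\<bar> \<le> N (\<Sum>j\<in>UNIV. w j *\<^sub>R x j)"
    using dual_ball_abs[OF N a(1)] unfolding flip_inner_combination[OF a(2), symmetric] .
next
  assume le: "\<forall>w i. \<bar>(\<Sum>j\<in>UNIV - {i}. w j) - w i\<bar> \<le> N (\<Sum>j\<in>UNIV. w j *\<^sub>R x j)"
  have "\<exists>b. b \<in> dual_ball N \<and> (\<forall>j. b \<bullet> x j = (if j = i then - 1 else 1))" for i
  proof -
    obtain g :: "'a \<Rightarrow> real" where g: "linear g" "\<And>v. v \<in> range x \<Longrightarrow> g v = (if v = x i then - 1 else 1)"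
      using linear_independent_extend[OF x(2), of "\<lambda>v. if v = x i then - 1 else 1"] by blast
    obtain b where b: "\<And>v. g v = b \<bullet> v" using linear_functional_inner[OF g(1)] by blast
    have bx: "b \<bullet> x j = (if j = i then - 1 else 1)" for j
      using g(2)[of "x j"] x(1) by (simp add: b inj_eq)
    have "b \<bullet> v \<le> N v" for v
    proof -
      obtain w where w: "v = (\<Sum>j\<in>UNIV. w j *\<^sub>R x j)" using basis_family_expansion[OF x card] by blast
      have "b \<bullet> v = (\<Sum>j\<in>UNIV - {i}. w j) - w i" unfolding w by (rule flip_inner_combination[OF bx])
      then show ?thesis using le[rule_format, where w = w and i = i] unfolding w[symmetric] by linarith
    qed
    then have "b \<in> dual_ball N" by (simp add: dual_ball_def)
    then show ?thesis using bx by blast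
  qed
  then show "\<exists>a. flipping N a x" unfolding flipping_def by (rule choice[OF allI])
qed

text \<open>
  The hyperplane where \<open>a i\<close> equals \<open>1\<close> supports the ball and contains the \<open>n\<close> points of
  \<open>x(i := - x i)\<close>. These are linearly independent, hence affinely independent, and so the face
  that they lie in has dimension \<open>n - 1\<close>. Conversely, a supporting hyperplane \<open>c \<bullet> v = b\<close> through
  these points has \<open>b > 0\<close>, because \<open>0\<close> is an interior point of the ball, and \<open>c / b\<close> serves as
  \<open>a i\<close>.
\<close>

lemma ex_flipping_iff_facets:
  fixes x :: "'i::finite \<Rightarrow> 'a::euclidean_space"
  assumes N: "norm_fun N" and card: "CARD('i) = DIM('a)" and x: "inj x" "independent (range x)"
    and ball: "\<And>i. x i \<in> unit_ball N"
  shows "(\<exists>a. flipping N a x) \<longleftrightarrow>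
    (\<forall>i. \<exists>F. body_facet (unit_ball N) F \<and> range (x(i := - x i)) \<subseteq> F)"
proof (intro iffI allI)
  fix i
  assume "\<exists>a. flipping N a x"
  then obtain a where a: "a i \<in> dual_ball N" "\<And>j. a i \<bullet> x j = (if j = i then - 1 else 1)"
    unfolding flipping_def by blast
  define y where "y = x(i := - x i)"
  define H where "H = {v. a i \<bullet> v = 1}"
  have yH: "range y \<subseteq> unit_ball N \<inter> H"
    using ball a(2) by (auto simp: y_def H_def unit_ball_def norm_fun_minus[OF N])
  have "a i \<noteq> 0" using a(2)[of i] by auto
  moreover have "unit_ball N \<subseteq> {v. a i \<bullet> v \<le> 1}"
    using a(1) order_trans unfolding dual_ball_def unit_ball_def by blast
  moreover have "unit_ball N \<inter> H \<noteq> {}" using yH by blast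
  ultimately have "supporting_hyperplane (unit_ball N) H"
    unfolding supporting_hyperplane_def H_def by blast
  then have face: "body_face (unit_ball N) (unit_ball N \<inter> H)" unfolding body_face_def by blast
  have y: "inj y \<and> independent (range y)"
    unfolding independent_family_iff
  proof (intro allI impI)
    fix w j assume w: "(\<Sum>j\<in>UNIV. w j *\<^sub>R y j) = 0"
    define w' where "w' = w(i := - w i)"
    have "(\<Sum>j\<in>UNIV. w' j *\<^sub>R x j) = (\<Sum>j\<in>UNIV. w j *\<^sub>R y j)"
      by (rule sum.cong) (auto simp: w'_def y_def)
    then have "w' j = 0" using w x independent_family_iff[of x] by auto
    then show "w j = 0" by (simp add: w'_def split: if_splits)
  qed
  then have "\<not> affine_dependent (range y)" using affine_dependent_imp_dependent by blast
  then have "int (card (range y)) = aff_dim (range y) + 1"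
    using aff_dim_affine_independent by force
  then have "aff_dim (range y) = int DIM('a) - 1" using y card by (simp add: card_image)
  moreover have "aff_dim (range y) \<le> aff_dim (unit_ball N \<inter> H)" by (rule aff_dim_subset[OF yH])
  moreover have "aff_dim (unit_ball N \<inter> H) \<le> aff_dim H" by (simp add: aff_dim_subset)
  moreover have "aff_dim H = int DIM('a) - 1" using \<open>a i \<noteq> 0\<close> by (simp add: H_def of_nat_diff)
  ultimately have "body_facet (unit_ball N) (unit_ball N \<inter> H)" using face by (simp add: body_facet_def)
  then show "\<exists>F. body_facet (unit_ball N) F \<and> range (x(i := - x i)) \<subseteq> F"
    using yH unfolding y_def by blast
next
  assume facets: "\<forall>i. \<exists>F. body_facet (unit_ball N) F \<and> range (x(i := - x i)) \<subseteq> F"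
  have "\<exists>b. b \<in> dual_ball N \<and> (\<forall>j. b \<bullet> x j = (if j = i then - 1 else 1))" for i
  proof -
    obtain c b where c: "c \<noteq> 0" "unit_ball N \<subseteq> {v. c \<bullet> v \<le> b}" "range (x(i := - x i)) \<subseteq> {v. c \<bullet> v = b}"
      using facets[rule_format, of i]
      unfolding body_facet_def body_face_def supporting_hyperplane_def by blast
    have "0 < N c" using c(1) norm_fun_nonneg[OF N, of c] norm_fun_eq_0[OF N, of c] by linarith
    then have "c /\<^sub>R N c \<in> unit_ball N" by (simp add: unit_ball_def norm_fun_scale[OF N])
    then have "c \<bullet> (c /\<^sub>R N c) \<le> b" using c(2) by blast
    moreover have "0 < c \<bullet> (c /\<^sub>R N c)" using \<open>0 < N c\<close> c(1) by simp
    ultimately have b: "0 < b" by linarith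
    have "c /\<^sub>R b \<in> dual_ball N"
    proof (rule dual_ballI_unit_ball[OF N])
      fix v assume "v \<in> unit_ball N"
      then have "c \<bullet> v \<le> b" using c(2) by blast
      then show "(c /\<^sub>R b) \<bullet> v \<le> 1" using b by (simp add: field_simps)
    qed
    moreover have "(c /\<^sub>R b) \<bullet> x j = (if j = i then - 1 else 1)" for j
    proof -
      have "c \<bullet> (x(i := - x i)) j = b" using c(3) by blast
      then show ?thesis using b by (auto simp: field_simps split: if_splits)
    qed
    ultimately show ?thesis by blast
  qed
  then show "\<exists>a. flipping N a x" unfolding flipping_def by (rule choice[OF allI])
qed

section \<open>The lower bound from flipping functionals\<close>

text \<open>
  Let \<open>c\<close> be the common value of \<open>\<phi>\<close> on the \<open>x i\<close>, let \<open>w\<close> be the coordinates of the kernel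
  direction \<open>z\<close>. Then the numbers \<open>c w i\<close> add up to \<open>\<phi> \<bullet> z = 1\<close>, so one of them is at most
  \<open>1 / n\<close>, and for this \<open>i\<close> the value \<open>a i \<bullet> P (x i) = 2 c w i - 2\<close> is at most \<open>- (2 - 2 / n)\<close>.
\<close>

lemma flipping_projection_lower_bound:
  fixes x :: "'i::finite \<Rightarrow> 'a::euclidean_space"
  assumes N: "norm_fun N" and card3: "CARD('i) \<ge> 3" and card: "CARD('i) = DIM('a)"
    and \<phi>: "\<phi> \<noteq> 0" and a: "flipping N a x" and ball: "\<And>i. x i \<in> unit_ball N"
    and const: "\<And>i j. \<phi> \<bullet> x i = \<phi> \<bullet> x j" and P: "P \<in> projections N {v. \<phi> \<bullet> v = 0}"
  shows "2 - 2 / real CARD('i) \<le> operator_norm N N P"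
proof -
  obtain z where z: "\<phi> \<bullet> z = 1" "P = (\<lambda>v. v - (\<phi> \<bullet> v) *\<^sub>R z)"
    using projection_rank_one[OF \<phi> P] by blast
  obtain w where w: "z = (\<Sum>j\<in>UNIV. w j *\<^sub>R x j)"
    using basis_family_expansion[of x z] flipping_independent[OF card3 a] card by blast
  define c where "c = \<phi> \<bullet> x undefined"
  have c: "\<phi> \<bullet> x j = c" for j unfolding c_def by (rule const)
  have sum1: "c * sum w UNIV = 1"
    using z(1) by (simp add: w inner_sum_right c mult.commute[of _ c] sum_distrib_left)
  have "\<exists>i. c * w i \<le> 1 / real CARD('i)"
  proof (rule ccontr)
    assume "\<nexists>i. c * w i \<le> 1 / real CARD('i)"
    then have "(\<Sum>i\<in>(UNIV::'i set). 1 / real CARD('i)) < (\<Sum>i\<in>UNIV. c * w i)"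
      by (intro sum_strict_mono) (auto simp: not_le)
    then show False using sum1 by (simp flip: sum_distrib_left)
  qed
  then obtain i where i: "c * w i \<le> 1 / real CARD('i)" by blast
  have ai: "a i \<in> dual_ball N" "\<And>j. a i \<bullet> x j = (if j = i then - 1 else 1)"
    using a by (auto simp: flipping_def)
  have "a i \<bullet> z = sum w UNIV - 2 * w i"
    unfolding w flip_inner_combination[OF ai(2)] by (simp add: sum.remove[of UNIV i])
  then have "a i \<bullet> P (x i) = - 1 - c * (sum w UNIV - 2 * w i)"
    by (simp add: z(2) c inner_diff_right ai(2))
  also have "\<dots> = 2 * (c * w i) - 2" using sum1 by (simp add: right_diff_distrib)
  finally have "2 - 2 / real CARD('i) \<le> - (a i \<bullet> P (x i))" using i by simp
  also have "\<dots> \<le> N (P (x i))" using dual_ball_abs[OF N ai(1), of "P (x i)"] by linarith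
  also have "\<dots> \<le> operator_norm N N P"
    by (rule operator_norm_upper[OF N _ ball]) (use P in \<open>simp add: projections_def\<close>)
  finally show ?thesis .
qed

section \<open>Optimal multipliers\<close>

text \<open>
  Caratheodory's theorem gives one point more. If that many points are needed, they are the
  vertices of a nondegenerate simplex and all weights are positive, so \<open>p\<close> is in its interior.
\<close>

lemma convex_hull_boundary_caratheodory:
  fixes S :: "'a::euclidean_space set"
  assumes p: "p \<in> convex hull S" "p \<notin> interior (convex hull S)"
  obtains T where "finite T" "T \<subseteq> S" "card T \<le> DIM('a)" "p \<in> convex hull T"
proof -
  obtain T where T: "finite T" "T \<subseteq> S" "card T \<le> DIM('a) + 1" "p \<in> convex hull T"
    using p(1) unfolding caratheodory[of S] by blast
  consider "card T \<le> DIM('a)" | "affine_dependent T" | "card T = DIM('a) + 1" "\<not> affine_dependent T"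
    using T(3) by linarith
  then show ?thesis
  proof cases
    case 1
    then show ?thesis using T that by blast
  next
    case 2
    then have "aff_dim T + 1 \<le> DIM('a)"
      using aff_dim_le_card[OF T(1)] T(1,3) affine_independent_iff_card[of T] by force
    moreover obtain T' where "finite T'" "T' \<subseteq> T" "card T' \<le> aff_dim T + 1" "p \<in> convex hull T'"
      using T(4) unfolding caratheodory_aff_dim[of T] by blast
    ultimately show ?thesis using T(2) that[of T'] by force
  next
    case 3
    obtain u where u: "\<And>v. v \<in> T \<Longrightarrow> 0 \<le> u v" "sum u T = 1" "(\<Sum>v\<in>T. u v *\<^sub>R v) = p"
      using T(4) unfolding convex_hull_finite[OF T(1)] by blast
    have "p \<notin> interior (convex hull T)"
      using p(2) interior_mono[OF hull_mono[OF T(2)]] by blast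
    then have "\<not> (\<forall>v\<in>T. 0 < u v)"
      using 3 u(2,3) unfolding interior_convex_hull_explicit_minimal[OF 3(2)] by auto
    then obtain v where v: "v \<in> T" "u v = 0" using u(1) by force
    have "sum u (T - {v}) = 1" "(\<Sum>w\<in>T - {v}. u w *\<^sub>R w) = p"
      using u(2,3) v T(1) by (simp_all add: sum_diff1)
    then have "p \<in> convex hull (T - {v})"
      using u(1) T(1) by (auto simp: convex_hull_finite)
    moreover have "card (T - {v}) \<le> DIM('a)" using T(1,3) v(1) by simp
    ultimately show ?thesis using T(1,2) that[of "T - {v}"] by blast
  qed
qed

text \<open>
  Here \<open>V (x, a)\<close> is chosen such that \<open>z \<bullet> V (x, a) = a \<bullet> P x\<close> for the projection \<open>P\<close> belonging
  to \<open>z\<close>. The convex hull \<open>C\<close> of these vectors is compact; \<open>M\<close> is the largest \<open>r\<close> with \<open>r \<phi> \<in> C\<close>.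
  If the projection constant \<open>L\<close> were larger than \<open>M\<close>, a hyperplane separating \<open>L \<phi>\<close> from \<open>C\<close>
  would yield a projection of smaller norm. It is the bound \<open>n\<close> on the number of multipliers, and
  not \<open>n + 1\<close>, that later produces the constant \<open>2 - 2 / n\<close>.
\<close>

lemma exists_optimal_multipliers:
  fixes N :: "'a::euclidean_space \<Rightarrow> real"
  assumes N: "norm_fun N" and \<phi>: "\<phi> \<noteq> 0"
    and card: "CARD('i::finite) = DIM('a)"
  obtains M :: real and l :: "'i::finite \<Rightarrow> real" and x a :: "'i::finite \<Rightarrow> 'a"
  where "projection_constant N {v. \<phi> \<bullet> v = 0} \<le> M"
    and "\<And>i. 0 \<le> l i" "sum l UNIV = 1"
    and "\<And>i. x i \<in> unit_ball N" "\<And>i. a i \<in> dual_ball N" "\<And>i. 0 \<le> \<phi> \<bullet> x i"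
    and "(\<Sum>i\<in>UNIV. l i *\<^sub>R ((a i \<bullet> x i) *\<^sub>R \<phi> - (\<phi> \<bullet> x i) *\<^sub>R a i)) = M *\<^sub>R \<phi>"
proof -
  let ?Y = "{v. \<phi> \<bullet> v = 0}"
  let ?L = "projection_constant N ?Y"
  define V where "V = (\<lambda>(x, a). (a \<bullet> x) *\<^sub>R \<phi> - (\<phi> \<bullet> x) *\<^sub>R a)"
  define S where "S = V ` (unit_ball N \<times> dual_ball N)"
  define C where "C = convex hull S"
  have "compact S" unfolding S_def V_def split_def
    by (intro compact_continuous_image compact_Times compact_unit_ball compact_dual_ball N continuous_intros)
  then have C: "compact C" "convex C" by (simp_all add: C_def compact_convex_hull)
  have dual0: "0 \<in> dual_ball N" by (simp add: dual_ball_def norm_fun_nonneg[OF N])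
  have "V (0, 0) \<in> S" unfolding S_def by (intro imageI) (simp add: zero_in_unit_ball[OF N] dual0)
  then have "0 \<in> C" by (simp add: C_def V_def hull_inc)
  define R where "R = {r. r *\<^sub>R \<phi> \<in> C}"
  have "closed R"
    using closed_vimage[OF compact_imp_closed[OF C(1)], of "\<lambda>r::real. r *\<^sub>R \<phi>"]
    by (simp add: R_def vimage_def continuous_intros)
  moreover have "bounded R"
  proof -
    obtain B where B: "\<And>v. v \<in> C \<Longrightarrow> norm v \<le> B"
      using compact_imp_bounded[OF C(1)] by (auto simp: bounded_iff)
    have "norm r \<le> B / norm \<phi>" if "r \<in> R" for r
      using B[of "r *\<^sub>R \<phi>"] that \<phi> by (simp add: R_def field_simps)
    then show ?thesis by (auto simp: bounded_iff)
  qed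
  ultimately have "compact R" by (simp add: compact_eq_bounded_closed)
  moreover have "0 \<in> R" using \<open>0 \<in> C\<close> by (simp add: R_def)
  ultimately obtain M where M: "M \<in> R" "\<And>r. r \<in> R \<Longrightarrow> r \<le> M"
    using compact_attains_sup[of R] by blast
  have "?L \<le> M"
  proof (rule ccontr)
    assume "\<not> ?L \<le> M"
    then have "?L \<notin> R" using M(2) by blast
    then have L: "0 < ?L" "?L *\<^sub>R \<phi> \<notin> C"
      using \<open>\<not> ?L \<le> M\<close> M(2)[OF \<open>0 \<in> R\<close>] by (simp_all add: R_def)
    obtain w b where w: "w \<bullet> (?L *\<^sub>R \<phi>) < b" "\<And>v. v \<in> C \<Longrightarrow> b < w \<bullet> v"
      using separating_hyperplane_closed_point[OF C(2) compact_imp_closed[OF C(1)] L(2)] by blast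
    have "b < 0" using w(2)[OF \<open>0 \<in> C\<close>] by simp
    then have "?L * (w \<bullet> \<phi>) < 0" using w(1) by simp
    then have w\<phi>: "w \<bullet> \<phi> < 0" using L(1) by (simp add: mult_less_0_iff)
    \<comment> \<open>The separating normal, rescaled to \<open>\<phi> \<bullet> z = 1\<close>, is the kernel direction of the better projection.\<close>
    define z where "z = w /\<^sub>R (w \<bullet> \<phi>)"
    define c where "c = b / (w \<bullet> \<phi>)"
    have z: "\<phi> \<bullet> z = 1" using w\<phi> by (simp add: z_def inner_commute)
    have "0 < c" using w\<phi> \<open>b < 0\<close> by (simp add: c_def divide_neg_neg)
    have "c < ?L" using w(1) w\<phi> by (simp add: c_def field_simps)
    define P where "P = (\<lambda>v. v - (\<phi> \<bullet> v) *\<^sub>R z)"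
    have "operator_norm N N P \<le> c"
    proof (rule operator_norm_least[OF N])
      fix x assume x: "x \<in> unit_ball N"
      show "N (P x) \<le> c"
      proof (rule norm_fun_le_dual[OF N \<open>0 < c\<close>])
        fix a assume a: "a \<in> dual_ball N"
        have "V (x, a) \<in> C" using x a by (auto simp: C_def S_def intro!: hull_inc)
        then have "b < w \<bullet> V (x, a)" by (rule w(2))
        then have "z \<bullet> V (x, a) \<le> c" using w\<phi> by (simp add: z_def c_def field_simps)
        moreover have "z \<bullet> V (x, a) = a \<bullet> P x"
          using z by (simp add: V_def P_def inner_diff_right inner_commute)
        ultimately show "a \<bullet> P x \<le> c" by simp
      qed
    qed
    moreover have "?L \<le> operator_norm N N P"
      unfolding P_def by (rule projection_constant_le[OF N rank_one_projection[OF N z]])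
    ultimately show False using \<open>c < ?L\<close> by simp
  qed
  have "M *\<^sub>R \<phi> \<notin> interior C"
  proof
    assume "M *\<^sub>R \<phi> \<in> interior C"
    then obtain e where e: "0 < e" "ball (M *\<^sub>R \<phi>) e \<subseteq> C" by (auto simp: mem_interior)
    have "dist (M *\<^sub>R \<phi>) ((M + e / (2 * norm \<phi>)) *\<^sub>R \<phi>) = e / 2"
      using \<phi> e(1) by (simp add: dist_norm scaleR_add_left)
    then have "(M + e / (2 * norm \<phi>)) *\<^sub>R \<phi> \<in> C" using e by auto
    then have "e / (2 * norm \<phi>) \<le> 0" using M(2) by (force simp: R_def)
    then show False using e(1) \<phi> by (simp add: divide_le_0_iff)
  qed
  then obtain T where T: "finite T" "T \<subseteq> S" "card T \<le> DIM('a)" "M *\<^sub>R \<phi> \<in> convex hull T"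
    using convex_hull_boundary_caratheodory[of "M *\<^sub>R \<phi>" S] M(1) unfolding C_def R_def by blast
  obtain u where u: "\<And>v. v \<in> T \<Longrightarrow> 0 \<le> u v" "sum u T = 1" "(\<Sum>v\<in>T. u v *\<^sub>R v) = M *\<^sub>R \<phi>"
    using T(4) unfolding convex_hull_finite[OF T(1)] by blast
  obtain h :: "'a \<Rightarrow> 'i" where h: "inj_on h T"
    using card_le_inj[OF T(1) finite[of "UNIV :: 'i set"]] T(3) card by auto
  \<comment> \<open>Replacing \<open>(x, a)\<close> by \<open>(- x, - a)\<close> does not change \<open>V (x, a)\<close>, so the sign of \<open>\<phi> \<bullet> x\<close> is free.\<close>
  have gen: "\<exists>p. fst p \<in> unit_ball N \<and> snd p \<in> dual_ball N \<and> 0 \<le> \<phi> \<bullet> fst p \<and> V p = v" if v: "v \<in> S" for v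
  proof -
    obtain x a where xa: "x \<in> unit_ball N" "a \<in> dual_ball N" "v = V (x, a)"
      using v unfolding S_def by blast
    show ?thesis
    proof (cases "0 \<le> \<phi> \<bullet> x")
      case True
      then show ?thesis using xa by (intro exI[of _ "(x, a)"]) simp
    next
      case False
      then show ?thesis using xa dual_ball_uminus[OF N]
        by (intro exI[of _ "(- x, - a)"]) (simp add: V_def unit_ball_def norm_fun_minus[OF N])
    qed
  qed
  define q where "q v = (SOME p. fst p \<in> unit_ball N \<and> snd p \<in> dual_ball N \<and> 0 \<le> \<phi> \<bullet> fst p \<and> V p = v)" for v
  have q: "fst (q v) \<in> unit_ball N \<and> snd (q v) \<in> dual_ball N \<and> 0 \<le> \<phi> \<bullet> fst (q v) \<and> V (q v) = v"
    if "v \<in> S" for v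
    unfolding q_def by (rule someI_ex[OF gen[OF that]])
  define g where "g = inv_into T h"
  \<comment> \<open>The at most \<open>n\<close> generators are spread over the index type; the remaining indices get weight \<open>0\<close>.\<close>
  define l where "l i = (if i \<in> h ` T then u (g i) else 0)" for i
  define p where "p i = (if i \<in> h ` T then q (g i) else (0, 0))" for i
  have g: "g (h v) = v" if "v \<in> T" for v using that h by (simp add: g_def)
  have sumUNIV: "(\<Sum>i\<in>UNIV. F i) = (\<Sum>v\<in>T. F (h v))" if "\<And>i. i \<notin> h ` T \<Longrightarrow> F i = 0"
    for F :: "'i \<Rightarrow> 'b::comm_monoid_add"
  proof -
    have "(\<Sum>i\<in>UNIV. F i) = (\<Sum>i\<in>h ` T. F i)"
      by (rule sum.mono_neutral_right) (use that in auto)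
    then show ?thesis by (simp add: sum.reindex[OF h])
  qed
  have p: "fst (p i) \<in> unit_ball N \<and> snd (p i) \<in> dual_ball N \<and> 0 \<le> \<phi> \<bullet> fst (p i)" for i
    using q T(2) g by (auto simp: p_def zero_in_unit_ball[OF N] dual0)
  show ?thesis
  proof (rule that[of M l "fst \<circ> p" "snd \<circ> p"])
    show "?L \<le> M" by fact
    show "0 \<le> l i" for i using u(1) g by (auto simp: l_def)
    have "sum l UNIV = (\<Sum>v\<in>T. l (h v))" by (rule sumUNIV) (simp add: l_def)
    also have "\<dots> = sum u T" by (rule sum.cong) (auto simp: l_def g)
    finally show "sum l UNIV = 1" using u(2) by simp
    have "(\<Sum>i\<in>UNIV. l i *\<^sub>R V (p i)) = (\<Sum>v\<in>T. l (h v) *\<^sub>R V (p (h v)))"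
      by (rule sumUNIV) (simp add: l_def)
    also have "\<dots> = (\<Sum>v\<in>T. u v *\<^sub>R v)"
      by (rule sum.cong) (use T(2) q in \<open>auto simp: l_def p_def g\<close>)
    finally show "(\<Sum>i\<in>UNIV. l i *\<^sub>R (((snd \<circ> p) i \<bullet> (fst \<circ> p) i) *\<^sub>R \<phi> -
        (\<phi> \<bullet> (fst \<circ> p) i) *\<^sub>R (snd \<circ> p) i)) = M *\<^sub>R \<phi>"
      using u(3) by (simp add: V_def split_def)
  qed (use p in auto)
qed

section \<open>The extremal inequality for multipliers\<close>

text \<open>
  In the application \<open>c j = \<phi> \<bullet> x j\<close> and \<open>A i j = a i \<bullet> x j\<close>. In the \<open>j\<close>-th equation the
  contributions of \<open>A j j\<close> cancel, and bounding the other entries by \<open>1\<close> leaves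
  \<open>(M - 1 + 2 l j) d j \<le> 1\<close>, where \<open>d j\<close> is \<open>c j\<close> divided by the weighted mean \<open>\<Lambda>\<close> of the \<open>c i\<close>.
  With \<open>\<kappa> = 1 - 2 / n \<le> M - 1\<close> this gives \<open>l j d j \<le> l j / (\<kappa> + 2 l j)\<close>. The function
  \<open>l / (\<kappa> + 2 l)\<close> is strictly concave with tangent \<open>2 / n\<^sup>2 + \<kappa> l\<close> at \<open>l = 1 / n\<close>. The sum of
  these tangent values over \<open>j\<close> is \<open>1\<close>, which is also the sum of the \<open>l j d j\<close>. Hence every
  estimate is an equality.
\<close>

lemma extremal_multipliers:
  fixes l c :: "'i::finite \<Rightarrow> real" and A :: "'i \<Rightarrow> 'i \<Rightarrow> real"
  assumes n: "CARD('i) \<ge> 3"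
    and l: "\<And>i. 0 \<le> l i" "sum l UNIV = 1"
    and c: "\<And>i. 0 \<le> c i"
    and A: "\<And>i j. \<bar>A i j\<bar> \<le> 1"
    and pos: "0 < (\<Sum>i\<in>UNIV. l i * c i)"
    and eq: "\<And>j. c j * (\<Sum>i\<in>UNIV. l i * A i i) - (\<Sum>i\<in>UNIV. l i * c i * A i j) = M * c j"
    and M: "2 - 2 / real CARD('i) \<le> M"
  shows "M = 2 - 2 / real CARD('i)"
    and "0 < c j" "c i = c j"
    and "A i i = 1" "i \<noteq> j \<Longrightarrow> A i j = - 1"
proof -
  define n where "n = real CARD('i)"
  have n3: "3 \<le> n" using n by (simp add: n_def)
  define \<kappa> where "\<kappa> = 1 - 2 / n"
  have \<kappa>: "0 < \<kappa>" using n3 by (simp add: \<kappa>_def field_simps)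
  define \<Lambda> where "\<Lambda> = (\<Sum>i\<in>UNIV. l i * c i)"
  have \<Lambda>: "0 < \<Lambda>" using pos by (simp add: \<Lambda>_def)
  have row: "(M - 1) * c j \<le> \<Lambda> - 2 * (l j * c j)" for j
  proof -
    have "M * c j = (\<Sum>i\<in>UNIV. c j * (l i * A i i) - l i * c i * A i j)"
      unfolding eq[symmetric] by (simp add: sum_subtractf sum_distrib_left)
    also have "\<dots> = (\<Sum>i\<in>UNIV - {j}. c j * (l i * A i i) - l i * c i * A i j)"
      by (simp add: sum.remove[of UNIV j])
    also have "\<dots> \<le> (\<Sum>i\<in>UNIV - {j}. c j * l i + l i * c i)"
    proof (rule sum_mono)
      fix i
      have "(c j * l i) * A i i \<le> (c j * l i) * 1" "(l i * c i) * (- A i j) \<le> (l i * c i) * 1"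
        using A[of i i] A[of i j] l(1)[of i] c[of i] c[of j] by (intro mult_left_mono; simp)+
      then show "c j * (l i * A i i) - l i * c i * A i j \<le> c j * l i + l i * c i" by simp
    qed
    also have "\<dots> = c j * (1 - l j) + (\<Lambda> - l j * c j)"
      using l(2) by (simp add: sum.distrib sum_diff1 \<Lambda>_def flip: sum_distrib_left)
    finally show ?thesis by (simp add: algebra_simps)
  qed
  define d where "d j = c j / \<Lambda>" for j
  have d0: "0 \<le> d j" for j using c \<Lambda> by (simp add: d_def)
  have \<rho>row: "(M - 1 + 2 * l j) * d j \<le> 1" for j
    using row[of j] \<Lambda> by (simp add: d_def field_simps)
  have "(\<kappa> + 2 * l j) * d j \<le> (M - 1 + 2 * l j) * d j" for j
    using M d0[of j] by (intro mult_right_mono) (auto simp: \<kappa>_def n_def)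
  then have drow: "(\<kappa> + 2 * l j) * d j \<le> 1" for j using \<rho>row order_trans by blast
  \<comment> \<open>The gap between the tangent line and the function.\<close>
  define E where "E j = 2 * \<kappa> * (l j - 1 / n)\<^sup>2 / (\<kappa> + 2 * l j)" for j
  have den: "0 < \<kappa> + 2 * l j" for j using \<kappa> l(1)[of j] by linarith
  have E0: "0 \<le> E j" for j using \<kappa> den[of j] by (simp add: E_def)
  have tangent: "l j * d j \<le> 2 / n\<^sup>2 + \<kappa> * l j - E j" for j
  proof -
    have id: "(\<kappa> + 2 * l j) * (2 / n\<^sup>2 + \<kappa> * l j) - l j = 2 * \<kappa> * (l j - 1 / n)\<^sup>2"
      using n3 by (simp add: \<kappa>_def field_simps power2_eq_square)
    have "(\<kappa> + 2 * l j) * (l j * d j) = l j * ((\<kappa> + 2 * l j) * d j)" by simp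
    also have "\<dots> \<le> l j" using drow[of j] l(1)[of j] by (rule mult_left_le)
    also have "\<dots> = (\<kappa> + 2 * l j) * (2 / n\<^sup>2 + \<kappa> * l j) - 2 * \<kappa> * (l j - 1 / n)\<^sup>2"
      using id by linarith
    also have "\<dots> = (\<kappa> + 2 * l j) * (2 / n\<^sup>2 + \<kappa> * l j - E j)"
      using den[of j] by (simp add: E_def right_diff_distrib)
    finally show ?thesis using den[of j] by simp
  qed
  have "(\<Sum>j\<in>UNIV. l j * d j) = 1" using \<Lambda> by (simp add: d_def \<Lambda>_def flip: sum_divide_distrib)
  moreover have "(\<Sum>j\<in>UNIV. l j * d j) \<le> (\<Sum>j\<in>UNIV. 2 / n\<^sup>2 + \<kappa> * l j - E j)"
    by (intro sum_mono tangent)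
  moreover have "(\<Sum>j\<in>UNIV. 2 / n\<^sup>2 + \<kappa> * l j - E j) = 1 - sum E UNIV"
    using n3 by (simp add: sum_subtractf sum.distrib l(2) \<kappa>_def power2_eq_square flip: sum_distrib_left n_def)
  ultimately have "sum E UNIV \<le> 0" by linarith
  then have "sum E UNIV = 0" using sum_nonneg[of UNIV E] E0 by force
  then have "E j = 0" for j using sum_nonneg_eq_0_iff[of UNIV E] E0 by simp
  then have lj: "l j = 1 / n" for j using \<kappa> den[of j] by (force simp: E_def)
  have d1: "d j \<le> 1" for j using drow[of j] by (simp add: lj \<kappa>_def)
  \<comment> \<open>The \<open>d j\<close> have mean \<open>1\<close> and are at most \<open>1\<close>.\<close>
  have "(\<Sum>j\<in>UNIV. 1 - d j) = 0"
    using \<open>(\<Sum>j\<in>UNIV. l j * d j) = 1\<close> n3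
    by (simp add: lj sum_subtractf flip: n_def sum_divide_distrib) 
  then have gap: "1 - d j = 0" for j
    using sum_nonneg_eq_0_iff[of UNIV "\<lambda>j. 1 - d j"] d1 by simp
  have dj: "d j = 1" for j using gap[of j] by simp
  then have cj: "c j = \<Lambda>" for j using \<Lambda> by (force simp: d_def)
  show "0 < c j" "c i = c j" using \<Lambda> by (simp_all add: cj)
  have "M - 1 + 2 / n \<le> 1" using \<rho>row[of undefined] by (simp add: dj lj)
  then show M_eq: "M = 2 - 2 / real CARD('i)" using M unfolding n_def by linarith
  \<comment> \<open>For fixed \<open>j\<close> the \<open>n - 1\<close> differences \<open>A i i - A i j\<close> with \<open>i \<noteq> j\<close> are at most \<open>2\<close> and add up to \<open>2 (n - 1)\<close>.\<close>
  have tight: "A i i = 1 \<and> A i j = - 1" if "i \<noteq> j" for i j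
  proof -
    have "\<Lambda> * ((\<Sum>i\<in>UNIV. A i i / n) - (\<Sum>i\<in>UNIV. A i j / n)) = \<Lambda> * M"
      using eq[of j] by (simp add: cj lj algebra_simps flip: sum_distrib_left sum_divide_distrib)
    then have "(\<Sum>i\<in>UNIV. A i i / n) - (\<Sum>i\<in>UNIV. A i j / n) = M" using \<Lambda> by simp
    then have "(\<Sum>i\<in>UNIV. A i i - A i j) = 2 * n - 2"
      using n3 M_eq by (simp add: sum_subtractf field_simps flip: sum_divide_distrib n_def)
    then have "(\<Sum>i\<in>UNIV - {j}. A i i - A i j) = 2 * n - 2"
      by (simp add: sum.remove[of UNIV j])
    then have "(\<Sum>i\<in>UNIV - {j}. 2 - (A i i - A i j)) = 0"
      by (simp add: sum_subtractf card_Diff_singleton n_def of_nat_diff)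
    moreover have nn: "0 \<le> 2 - (A i i - A i j)" for i using A[of i i] A[of i j] by linarith
    ultimately have "2 - (A i i - A i j) = 0"
      using that sum_nonneg_eq_0_iff[of "UNIV - {j}" "\<lambda>i. 2 - (A i i - A i j)"] by simp
    then show ?thesis using A[of i i] A[of i j] by linarith
  qed
  then show "i \<noteq> j \<Longrightarrow> A i j = - 1" by blast
  have "\<exists>k. k \<noteq> i"
  proof (rule ccontr)
    assume "\<nexists>k. k \<noteq> i"
    then have "(UNIV :: 'i set) = {i}" by auto
    then have "CARD('i) = 1" by (metis card_1_singleton_iff One_nat_def)
    then show False using n by simp
  qed
  then show "A i i = 1" using tight by metis
qed

section \<open>The maximal projection constant\<close>

text \<open>
  The optimal multipliers turn the lower bound on the projection constant into \<open>M \<ge> 2 - 2 / n\<close>,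
  the extremal case of the inequality for multipliers, where the \<open>- a i\<close> are flipping. The first
  conclusion contains the general upper bound \<open>2 - 2 / n\<close> for projection constants of
  hyperplanes, due to Bohnenblust.
\<close>

lemma large_projection_constant_imp_flipping:
  fixes N :: "'a::euclidean_space \<Rightarrow> real"
  assumes N: "norm_fun N" and \<phi>: "\<phi> \<noteq> 0"
    and card3: "CARD('i::finite) \<ge> 3" and card: "CARD('i) = DIM('a)"
    and large: "2 - 2 / real CARD('i) \<le> projection_constant N {v. \<phi> \<bullet> v = 0}"
  shows "projection_constant N {v. \<phi> \<bullet> v = 0} = 2 - 2 / real CARD('i)"
    and "\<exists>(x :: 'i \<Rightarrow> 'a) a. flipping N a x \<and> (\<forall>i. x i \<in> unit_ball N) \<and> (\<forall>i j. \<phi> \<bullet> x i = \<phi> \<bullet> x j)"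
proof -
  obtain M and l :: "'i \<Rightarrow> real" and x a :: "'i \<Rightarrow> 'a" where
    M: "projection_constant N {v. \<phi> \<bullet> v = 0} \<le> M"
    and l: "\<And>i. 0 \<le> l i" "sum l UNIV = 1"
    and x: "\<And>i. x i \<in> unit_ball N" and a: "\<And>i. a i \<in> dual_ball N"
    and c: "\<And>i. 0 \<le> \<phi> \<bullet> x i"
    and eq: "(\<Sum>i\<in>UNIV. l i *\<^sub>R ((a i \<bullet> x i) *\<^sub>R \<phi> - (\<phi> \<bullet> x i) *\<^sub>R a i)) = M *\<^sub>R \<phi>"
    using exists_optimal_multipliers[OF N \<phi> card] by blast
  have A: "\<bar>a i \<bullet> x j\<bar> \<le> 1" for i j
    using dual_ball_abs[OF N a, of i "x j"] x[of j] by (simp add: unit_ball_def)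
  have large': "2 - 2 / real CARD('i) \<le> M" using large M by linarith
  have eq_inner: "(\<phi> \<bullet> y) * (\<Sum>i\<in>UNIV. l i * (a i \<bullet> x i)) - (\<Sum>i\<in>UNIV. l i * (\<phi> \<bullet> x i) * (a i \<bullet> y))
      = M * (\<phi> \<bullet> y)" for y
  proof -
    have "M * (\<phi> \<bullet> y) = (\<Sum>i\<in>UNIV. l i *\<^sub>R ((a i \<bullet> x i) *\<^sub>R \<phi> - (\<phi> \<bullet> x i) *\<^sub>R a i)) \<bullet> y"
      by (simp add: eq)
    also have "\<dots> = (\<Sum>i\<in>UNIV. (\<phi> \<bullet> y) * (l i * (a i \<bullet> x i)) - l i * (\<phi> \<bullet> x i) * (a i \<bullet> y))"
      by (simp add: inner_sum_left inner_diff_left algebra_simps)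
    finally show ?thesis by (simp add: sum_subtractf sum_distrib_left)
  qed
  \<comment> \<open>If this sum vanishes, the representation of \<open>M \<phi>\<close> involves only multiples of \<open>\<phi>\<close>, and \<open>M \<le> 1\<close>.\<close>
  have pos: "0 < (\<Sum>i\<in>UNIV. l i * (\<phi> \<bullet> x i))"
  proof (rule ccontr)
    assume "\<not> 0 < (\<Sum>i\<in>UNIV. l i * (\<phi> \<bullet> x i))"
    then have "(\<Sum>i\<in>UNIV. l i * (\<phi> \<bullet> x i)) = 0"
      using sum_nonneg[of UNIV "\<lambda>i. l i * (\<phi> \<bullet> x i)"] l(1) c by force
    then have zero: "l i * (\<phi> \<bullet> x i) = 0" for i
      using sum_nonneg_eq_0_iff[of UNIV "\<lambda>i. l i * (\<phi> \<bullet> x i)"] l(1) c by simp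
    have "(\<Sum>i\<in>UNIV. l i * (a i \<bullet> x i)) = M"
      using eq_inner[of \<phi>] \<phi> unfolding zero by simp
    moreover have "(\<Sum>i\<in>UNIV. l i * (a i \<bullet> x i)) \<le> (\<Sum>i\<in>UNIV. l i * 1)"
      using A l(1) by (intro sum_mono mult_left_mono) (auto simp: abs_le_iff)
    ultimately have "M \<le> 1" using l(2) by simp
    moreover have "2 / real CARD('i) < 1" using card3 by simp
    ultimately show False using large' by linarith
  qed
  note extremal = extremal_multipliers[where c = "\<lambda>i. \<phi> \<bullet> x i" and A = "\<lambda>i j. a i \<bullet> x j",
      OF card3 l c A pos eq_inner large']
  show "projection_constant N {v. \<phi> \<bullet> v = 0} = 2 - 2 / real CARD('i)"
    using extremal(1) M large by linarith
  have "flipping N (\<lambda>i. - a i) x"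
    using extremal(4,5) dual_ball_uminus[OF N a] by (auto simp: flipping_def)
  then show "\<exists>(x :: 'i \<Rightarrow> 'a) a. flipping N a x \<and> (\<forall>i. x i \<in> unit_ball N) \<and> (\<forall>i j. \<phi> \<bullet> x i = \<phi> \<bullet> x j)"
    using x extremal(3) by blast
qed

lemma projection_constant_eq_iff_flipping:
  fixes N :: "'a::euclidean_space \<Rightarrow> real"
  assumes N: "norm_fun N" and \<phi>: "\<phi> \<noteq> 0"
    and card3: "CARD('i::finite) \<ge> 3" and card: "CARD('i) = DIM('a)"
  shows "projection_constant N {v. \<phi> \<bullet> v = 0} = 2 - 2 / real CARD('i) \<longleftrightarrow>
    (\<exists>(x :: 'i \<Rightarrow> 'a) a. flipping N a x \<and> (\<forall>i. x i \<in> unit_ball N) \<and> (\<forall>i j. \<phi> \<bullet> x i = \<phi> \<bullet> x j))"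
    (is "?eq \<longleftrightarrow> ?flip")
proof
  assume ?eq
  then show ?flip by (intro large_projection_constant_imp_flipping(2)[OF assms]) simp
next
  assume ?flip
  then obtain x :: "'i \<Rightarrow> 'a" and a where x: "flipping N a x" "\<And>i. x i \<in> unit_ball N" "\<And>i j. \<phi> \<bullet> x i = \<phi> \<bullet> x j"
    by blast
  have "2 - 2 / real CARD('i) \<le> projection_constant N {v. \<phi> \<bullet> v = 0}"
    unfolding projection_constant_def
    by (intro cINF_greatest projections_nonempty[OF N \<phi>]
        flipping_projection_lower_bound[OF N card3 card \<phi> x])
  then show ?eq by (rule large_projection_constant_imp_flipping(1)[OF assms])
qed

text \<open>
  By \<open>flipping_extreme_point\<close> and \<open>flipping_independent\<close>, it makes no difference whether one asks
  for points of the ball with flipping functionals or for linearly independent extreme points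
  that satisfy the inequality.
\<close>

theorem theorem1p4:
  fixes N :: "real ^ 'n \<Rightarrow> real"
    and f :: "real ^ 'n \<Rightarrow> real"
    and Y :: "(real ^ 'n) set"
  assumes "CARD('n) \<ge> 3"
    and "norm_fun N"
    and "f \<in> dual_unit_sphere N"
    and "Y = {v. f v = 0}"
  shows "(projection_constant N Y = 2 - 2 / real CARD('n) \<longleftrightarrow>
           (\<exists>x :: 'n \<Rightarrow> real ^ 'n.
              (\<forall>i. x i extreme_point_of unit_ball N) \<and>
              (\<forall>i j. f (x i) = f (x j)) \<and>
              (inj x \<and> independent (range x)) \<and>
              (\<forall>v w. v = (\<Sum>i\<in>UNIV. w i *\<^sub>R x i) \<longrightarrow>
                 (MAX i\<in>UNIV. \<bar>(\<Sum>j\<in>UNIV - {i}. w j) - w i\<bar>) \<le> N v))) \<and>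
         (\<forall>x :: 'n \<Rightarrow> real ^ 'n.
            (\<forall>i. x i extreme_point_of unit_ball N) \<longrightarrow>
            (\<forall>i j. f (x i) = f (x j)) \<longrightarrow>
            (inj x \<and> independent (range x)) \<longrightarrow>
            ((\<forall>v w. v = (\<Sum>i\<in>UNIV. w i *\<^sub>R x i) \<longrightarrow>
                 (MAX i\<in>UNIV. \<bar>(\<Sum>j\<in>UNIV - {i}. w j) - w i\<bar>) \<le> N v) \<longleftrightarrow>
             (\<forall>i. \<exists>F. body_facet (unit_ball N) F \<and> range (x(i := - x i)) \<subseteq> F)))"
proof -
  note card3 = assms(1) and N = assms(2)
  have card: "CARD('n) = DIM(real ^ 'n)" by simp
  have lin: "linear f" and norm1: "operator_norm N abs f = 1"
    using assms(3) by (auto simp: dual_unit_sphere_def bounded_operator_def)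
  obtain \<phi> where f: "\<And>v. f v = \<phi> \<bullet> v" using linear_functional_inner[OF lin] by blast
  have \<phi>: "\<phi> \<noteq> 0"
    using norm1 operator_norm_least[OF N, of abs f 0] by (auto simp: f)
  let ?ineq = "\<lambda>x. \<forall>v w. v = (\<Sum>i\<in>UNIV. w i *\<^sub>R x i) \<longrightarrow>
      (MAX i\<in>UNIV. \<bar>(\<Sum>j\<in>UNIV - {i}. w j) - w i\<bar>) \<le> N v"
  have flip_iff: "?ineq x \<longleftrightarrow> (\<exists>a. flipping N a x)" if "inj x" "independent (range x)" for x :: "'n \<Rightarrow> real ^ 'n"
    unfolding ex_flipping_iff_inequality[OF N card that] by (simp add: Max_le_iff)
  have extreme_ball: "x \<in> unit_ball N" if "x extreme_point_of unit_ball N" for x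
    using that by (simp add: extreme_point_of_def)
  have "(\<exists>(x :: 'n \<Rightarrow> real ^ 'n) a. flipping N a x \<and> (\<forall>i. x i \<in> unit_ball N) \<and> (\<forall>i j. \<phi> \<bullet> x i = \<phi> \<bullet> x j)) \<longleftrightarrow>
      (\<exists>x :: 'n \<Rightarrow> real ^ 'n. (\<forall>i. x i extreme_point_of unit_ball N) \<and> (\<forall>i j. f (x i) = f (x j)) \<and>
        (inj x \<and> independent (range x)) \<and> ?ineq x)"
      (is "?L \<longleftrightarrow> ?R")
  proof
    assume ?L
    then obtain x :: "'n \<Rightarrow> real ^ 'n" and a
      where x: "flipping N a x" "\<forall>i. x i \<in> unit_ball N" "\<forall>i j. \<phi> \<bullet> x i = \<phi> \<bullet> x j" by blast
    then have ind: "inj x \<and> independent (range x)" by (intro flipping_independent[OF card3])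
    moreover have "\<forall>i. x i extreme_point_of unit_ball N"
      using flipping_extreme_point[OF N card3 card x(1)] x(2) by blast
    moreover have "?ineq x" using flip_iff ind x(1) by blast
    ultimately show ?R using x(3) unfolding f by blast
  next
    assume ?R
    then obtain x :: "'n \<Rightarrow> real ^ 'n"
      where x: "\<forall>i. x i extreme_point_of unit_ball N" "\<forall>i j. \<phi> \<bullet> x i = \<phi> \<bullet> x j"
        and ind: "inj x" "independent (range x)" and ineq: "?ineq x" unfolding f by blast
    have "\<exists>a. flipping N a x" using flip_iff[OF ind] ineq by (rule iffD1)
    then show ?L using x extreme_ball by blast
  qed
  then have "projection_constant N Y = 2 - 2 / real CARD('n) \<longleftrightarrow>
      (\<exists>x :: 'n \<Rightarrow> real ^ 'n. (\<forall>i. x i extreme_point_of unit_ball N) \<and> (\<forall>i j. f (x i) = f (x j)) \<and>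
        (inj x \<and> independent (range x)) \<and> ?ineq x)"
    using projection_constant_eq_iff_flipping[OF N \<phi> card3 card] unfolding assms(4) f by simp
  moreover have "?ineq x \<longleftrightarrow> (\<forall>i. \<exists>F. body_facet (unit_ball N) F \<and> range (x(i := - x i)) \<subseteq> F)"
    if x: "\<forall>i. x i extreme_point_of unit_ball N" "inj x \<and> independent (range x)" for x :: "'n \<Rightarrow> real ^ 'n"
  proof -
    have "\<And>i. x i \<in> unit_ball N" using x(1) extreme_ball by blast
    then show ?thesis
      using flip_iff ex_flipping_iff_facets[OF N card, of x] x(2) by simp
  qed
  ultimately show ?thesis by (intro conjI allI impI) assumption
qed

end
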